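(* For every integer $k \geq 3$ and every integer $\Delta > 100k^2$, there exists a finite $k$-uniform linear hypergraph $G$ with maximum degree $\Delta$ such that the independence polynomial $Z_G$ has a negative real zero $\lambda$ with $\lambda \in \left[-\frac{6k \log \Delta}{\Delta}, 0\right]$.
   Context: A hypergraph $G = (V, E)$ is a finite set of vertices $V$ together with a set of edges $E \subset 2^V$. It is $k$-uniform if every edge has size $k$. It is linear if each pair of distinct edges intersect in at most one vertex. The degree $d(v)$ of a vertex $v \in V$ is the number of edges containing $v$, and the maximum degree of $G$ is the maximum of $d(v)$ over $v \in V$. An independent set in $G$ is a set $I \subset V$ such that $I$ contains no edge of $G$ as a subset; $\mathcal{I}(G)$ denotes the family of all independent sets of $G$. The independence polynomial of $G$ is $Z_G(\lambda) = \sum_{I \in \mathcal{I}(G)} \lambda^{|I|}$. Here $\log$ is the natural logarithm. *)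

theory Defs
  imports Complex_Main "HOL-Computational_Algebra.Polynomial"
begin

definition hypergraph :: "'a set \<Rightarrow> 'a set set \<Rightarrow> bool" where
  "hypergraph V E \<longleftrightarrow> finite V \<and> E \<subseteq> Pow V"

definition uniform_edges :: "nat \<Rightarrow> 'a set set \<Rightarrow> bool" where
  "uniform_edges k E \<longleftrightarrow> (\<forall>e\<in>E. finite e \<and> card e = k)"

definition linear_edges :: "'a set set \<Rightarrow> bool" where
  "linear_edges E \<longleftrightarrow> (\<forall>e\<in>E. \<forall>f\<in>E. e \<noteq> f \<longrightarrow> finite (e \<inter> f) \<and> card (e \<inter> f) \<le> 1)"

definition vertex_degree :: "'a set set \<Rightarrow> 'a \<Rightarrow> nat" where
  "vertex_degree E v = card {e \<in> E. v \<in> e}"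

text \<open>Inserting \<open>0\<close> only matters for an empty vertex set, where it makes the maximum degree \<open>0\<close>
  instead of the unspecified value \<open>Max {}\<close>.\<close>

definition max_degree :: "'a set \<Rightarrow> 'a set set \<Rightarrow> nat" where
  "max_degree V E = Max (insert 0 (vertex_degree E ` V))"

definition independent_sets :: "'a set \<Rightarrow> 'a set set \<Rightarrow> 'a set set" where
  "independent_sets V E = {I. I \<subseteq> V \<and> \<not> (\<exists>e\<in>E. e \<subseteq> I)}"

definition independence_poly :: "'a set \<Rightarrow> 'a set set \<Rightarrow> real poly" where
  "independence_poly V E = (\<Sum>I\<in>independent_sets V E. monom 1 (card I))"

end

theory Submission
  imports Defs
begin

text \<open>
  Take an \<open>r\<close>-uniform linear hypergraph \<open>H = (B, F)\<close> with \<open>r = k - 1\<close>, in which every degree is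
  \<open>\<Delta>\<close> or \<open>\<Delta> - 1\<close>, and enlarge every edge by a private new vertex of degree one. The resulting
  \<open>k\<close>-uniform hypergraph \<open>G\<close> is again linear. Once the trace \<open>T \<subseteq> B\<close> of an independent set is
  chosen, the private vertices of edges inside \<open>T\<close> are forbidden and all others are free, so
  \<open>Z_G(z) = (\<Sum>T\<in>Pow B. z ^ card T * (1 + z) ^ h(T))\<close>,
  where \<open>h(T)\<close> is the number of edges of \<open>H\<close> that are not contained in \<open>T\<close>
  (\<open>poly_independence_poly_expansion\<close>).

  Put \<open>z = - x\<close> with \<open>0 < x \<le> 1\<close>. The term of \<open>T = B\<close> is \<open>(- x) ^ card B\<close>. Every edge has only \<open>r\<close>
  vertices, so omitting \<open>t\<close> vertices from \<open>T\<close> makes \<open>h(T)\<close> at least \<open>t (\<Delta> - 1) / r\<close>: each omitted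
  vertex gains a factor \<open>1 / x\<close> but costs a factor \<open>q = exp (- x (\<Delta> - 1) / r)\<close>. For
  \<open>x = 6 k ln \<Delta> / \<Delta>\<close> the quotient \<open>q / x\<close> is so small that the term of \<open>T = B\<close> outweighs all the
  others together. If \<open>B\<close> has an odd number of vertices this term is negative, hence
  \<open>Z_G(- x) \<le> 0\<close> (\<open>independence_poly_expansion_nonpos\<close>), while \<open>Z_G(0) = 1\<close>, and the intermediate
  value theorem yields the zero.

  For \<open>H\<close> one can take the lines \<open>{(i, a + i b) | i < r}\<close> over the integers modulo
  \<open>m = 2 r \<Delta>\<close>, with \<open>\<Delta>\<close> slopes \<open>0 \<le> b < \<Delta>\<close>. These slopes are so few that two lines with two
  common points agree even though \<open>m\<close> is not prime. The \<open>r m\<close> points are even in number;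
  removing the point \<open>(0, 0)\<close> and all lines through it makes the number odd and lowers the other
  degrees by at most one. The point \<open>(0, 1)\<close> keeps degree \<open>\<Delta>\<close>.
\<close>

section \<open>The independence polynomial as a sum over independent sets\<close>

lemma sum_power_card_Pow:
  fixes y z :: "'b :: comm_ring_1"
  assumes "finite A"
  shows "(\<Sum>X\<in>Pow A. y ^ card X * z ^ card (A - X)) = (y + z) ^ card A"
  using prod_add[OF assms, of "\<lambda>_. y" "\<lambda>_. z"] by simp

lemma poly_independence_poly:
  "poly (independence_poly V E) z = (\<Sum>I\<in>independent_sets V E. z ^ card I)"
  by (simp add: independence_poly_def poly_sum poly_monom)

lemma poly_independence_poly_0:
  assumes "finite V" and "{} \<notin> E"
  shows "poly (independence_poly V E) 0 = 1"
proof -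
  have fin: "finite (independent_sets V E)"
    using assms(1) by (auto simp: independent_sets_def intro: finite_subset[of _ "Pow V"])
  have "(0::real) ^ card I = (if I = {} then 1 else 0)" if "I \<in> independent_sets V E" for I
    using that assms(1) by (auto simp: independent_sets_def card_eq_0_iff power_0_left
        dest: finite_subset)
  then have "poly (independence_poly V E) 0
      = (\<Sum>I\<in>independent_sets V E. if I = {} then 1 else 0)"
    by (simp add: poly_independence_poly)
  also have "\<dots> = 1"
    using fin assms(2) by (simp add: sum.delta independent_sets_def)
  finally show ?thesis .
qed

section \<open>Isomorphic copies\<close>

text \<open>The constructions below live on structured vertex types. As all notions involved are
  invariant under injective renaming of the vertices, the result can be moved to the naturals.\<close>

lemma inj_on_image_family:
  assumes "inj_on f V" and "E \<subseteq> Pow V"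
  shows "inj_on ((`) f) E"
  using assms by (meson inj_on_image_Pow inj_on_subset)

lemma hypergraph_image: "hypergraph V E \<Longrightarrow> hypergraph (f ` V) ((`) f ` E)"
  unfolding hypergraph_def by blast

lemma uniform_edges_image:
  assumes "inj_on f V" and "E \<subseteq> Pow V" and "uniform_edges k E"
  shows "uniform_edges k ((`) f ` E)"
  unfolding uniform_edges_def
proof
  fix e' assume "e' \<in> (`) f ` E"
  then obtain e where e: "e \<in> E" "e' = f ` e" by auto
  then have "inj_on f e" using assms(1,2) by (meson PowD in_mono inj_on_subset)
  then show "finite e' \<and> card e' = k"
    using e assms(3) by (auto simp: uniform_edges_def card_image)
qed

lemma linear_edges_image:
  assumes "inj_on f V" and "E \<subseteq> Pow V" and "linear_edges E"
  shows "linear_edges ((`) f ` E)"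
  unfolding linear_edges_def
proof (intro ballI impI)
  fix e' g' assume "e' \<in> (`) f ` E" "g' \<in> (`) f ` E" and ne: "e' \<noteq> g'"
  then obtain e g where eg: "e \<in> E" "e' = f ` e" "g \<in> E" "g' = f ` g" by auto
  then have "f ` (e \<inter> g) = e' \<inter> g'"
    using inj_on_image_Int[OF assms(1), of e g] assms(2) by auto
  moreover have "finite (e \<inter> g)" "card (e \<inter> g) \<le> 1"
    using assms(3) eg ne by (auto simp: linear_edges_def)
  ultimately show "finite (e' \<inter> g') \<and> card (e' \<inter> g') \<le> 1"
    by (metis card_image_le finite_imageI le_trans)
qed

lemma vertex_degree_image:
  assumes "inj_on f V" and "E \<subseteq> Pow V" and "v \<in> V"
  shows "vertex_degree ((`) f ` E) (f v) = vertex_degree E v"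
proof -
  have "f v \<in> f ` e \<longleftrightarrow> v \<in> e" if "e \<in> E" for e
    using assms that by (auto dest: inj_onD)
  then have "{e' \<in> (`) f ` E. f v \<in> e'} = (`) f ` {e \<in> E. v \<in> e}"
    by auto
  moreover have "inj_on ((`) f) {e \<in> E. v \<in> e}"
    by (rule inj_on_image_family[OF assms(1)]) (use assms(2) in auto)
  ultimately show ?thesis
    by (simp add: vertex_degree_def card_image)
qed

lemma max_degree_image:
  assumes "inj_on f V" and "E \<subseteq> Pow V"
  shows "max_degree (f ` V) ((`) f ` E) = max_degree V E"
proof -
  have "vertex_degree ((`) f ` E) ` f ` V = vertex_degree E ` V"
    using vertex_degree_image[OF assms] by (auto simp: image_image)
  then show ?thesis by (simp add: max_degree_def)
qed

lemma independence_poly_image: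
  assumes "inj_on f V" and "E \<subseteq> Pow V"
  shows "independence_poly (f ` V) ((`) f ` E) = independence_poly V E"
proof -
  have sub: "f ` e \<subseteq> f ` I \<longleftrightarrow> e \<subseteq> I" if "e \<in> E" "I \<subseteq> V" for e I
    using inj_on_image_eq_iff[OF assms(1), of "e \<union> I" I] that assms(2)
    by (auto simp: image_Un subset_Un_eq)
  have "independent_sets (f ` V) ((`) f ` E) = (`) f ` independent_sets V E"
  proof (intro equalityI subsetI)
    fix J assume J: "J \<in> independent_sets (f ` V) ((`) f ` E)"
    then obtain I where "I \<subseteq> V" "J = f ` I"
      by (auto simp: independent_sets_def subset_image_iff)
    with J show "J \<in> (`) f ` independent_sets V E"
      using sub by (intro image_eqI[of _ _ I]) (auto simp: independent_sets_def)
  next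
    fix J assume "J \<in> (`) f ` independent_sets V E"
    then show "J \<in> independent_sets (f ` V) ((`) f ` E)"
      using sub by (auto simp: independent_sets_def)
  qed
  moreover have "inj_on ((`) f) (independent_sets V E)"
    by (rule inj_on_image_family[OF assms(1)]) (auto simp: independent_sets_def)
  moreover have "card (f ` I) = card I" if "I \<in> independent_sets V E" for I
    using that assms(1) by (intro card_image) (auto simp: independent_sets_def inj_on_subset)
  ultimately show ?thesis
    by (simp add: independence_poly_def sum.reindex)
qed

section \<open>Expanding every edge by a private vertex\<close>

text \<open>The edge itself serves as the name of its private vertex: \<open>Inl\<close> tags the old vertices and
  \<open>Inr\<close> the new ones.\<close>

definition expanded_edge :: "'a set \<Rightarrow> ('a + 'a set) set" where
  "expanded_edge f = insert (Inr f) (Inl ` f)"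

lemma expanded_edge_eq_iff [simp]: "expanded_edge f = expanded_edge g \<longleftrightarrow> f = g"
  by (auto simp: expanded_edge_def)

lemma inj_expanded_edge: "inj_on expanded_edge F"
  by (simp add: inj_on_def)

lemma hypergraph_expansion:
  assumes "hypergraph B F"
  shows "hypergraph (B <+> F) (expanded_edge ` F)"
proof -
  have "finite F" using assms by (auto simp: hypergraph_def intro: finite_subset)
  then show ?thesis using assms by (auto simp: hypergraph_def expanded_edge_def)
qed

lemma uniform_edges_expansion:
  assumes "uniform_edges r F"
  shows "uniform_edges (Suc r) (expanded_edge ` F)"
  unfolding uniform_edges_def expanded_edge_def
proof
  fix e assume "e \<in> (\<lambda>f. insert (Inr f) (Inl ` f)) ` F"
  then obtain f where f: "f \<in> F" "e = insert (Inr f) (Inl ` f)" by auto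
  moreover have "card (Inl ` f) = card f" by (simp add: card_image)
  ultimately show "finite e \<and> card e = Suc r"
    using assms by (auto simp: uniform_edges_def card_insert_if)
qed

lemma linear_edges_expansion:
  assumes "linear_edges F"
  shows "linear_edges (expanded_edge ` F)"
  unfolding linear_edges_def
proof (intro ballI impI)
  fix e e' assume "e \<in> expanded_edge ` F" "e' \<in> expanded_edge ` F" and ne: "e \<noteq> e'"
  then obtain f g where fg: "f \<in> F" "g \<in> F" "e = expanded_edge f" "e' = expanded_edge g" "f \<noteq> g"
    by auto
  have "e \<inter> e' = Inl ` (f \<inter> g)"
    using fg by (auto simp: expanded_edge_def)
  moreover have "finite (f \<inter> g)" "card (f \<inter> g) \<le> 1"
    using assms fg by (auto simp: linear_edges_def)
  ultimately show "finite (e \<inter> e') \<and> card (e \<inter> e') \<le> 1"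
    by (simp add: card_image)
qed

lemma vertex_degree_expansion_Inl:
  "vertex_degree (expanded_edge ` F) (Inl v) = vertex_degree F v"
proof -
  have "{e \<in> expanded_edge ` F. Inl v \<in> e} = expanded_edge ` {f \<in> F. v \<in> f}"
    by (auto simp: expanded_edge_def)
  then show ?thesis by (simp add: vertex_degree_def card_image inj_expanded_edge)
qed

lemma vertex_degree_expansion_Inr:
  assumes "g \<in> F"
  shows "vertex_degree (expanded_edge ` F) (Inr g) = 1"
proof -
  have "{e \<in> expanded_edge ` F. Inr g \<in> e} = {expanded_edge g}"
    using assms by (auto simp: expanded_edge_def)
  then show ?thesis by (simp add: vertex_degree_def)
qed

lemma max_degree_expansion:
  assumes "hypergraph B F" and "v \<in> B" and "vertex_degree F v = d" and "d \<ge> 1"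
    and "\<And>u. u \<in> B \<Longrightarrow> vertex_degree F u \<le> d"
  shows "max_degree (B <+> F) (expanded_edge ` F) = d"
  unfolding max_degree_def
proof (rule Max_eqI)
  have "finite (B <+> F)"
    using hypergraph_expansion[OF assms(1)] by (simp add: hypergraph_def)
  then show "finite (insert 0 (vertex_degree (expanded_edge ` F) ` (B <+> F)))" by blast
  show "y \<le> d" if "y \<in> insert 0 (vertex_degree (expanded_edge ` F) ` (B <+> F))" for y
    using that assms(4,5)
    by (auto simp: vertex_degree_expansion_Inl vertex_degree_expansion_Inr)
  have "d = vertex_degree (expanded_edge ` F) (Inl v)"
    using assms(3) by (simp add: vertex_degree_expansion_Inl)
  then show "d \<in> insert 0 (vertex_degree (expanded_edge ` F) ` (B <+> F))"
    using assms(2) by blast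
qed

text \<open>An independent set of the expansion is a disjoint union \<open>T <+> S\<close>, where \<open>T \<subseteq> B\<close> is arbitrary
  and \<open>S\<close> consists of private vertices of edges that are not contained in \<open>T\<close>. Summing over \<open>S\<close>
  first gives the power of \<open>1 + z\<close>.\<close>

lemma poly_independence_poly_expansion:
  assumes "hypergraph B F"
  shows "poly (independence_poly (B <+> F) (expanded_edge ` F)) z
    = (\<Sum>T\<in>Pow B. z ^ card T * (1 + z) ^ card {f \<in> F. \<not> f \<subseteq> T})"
proof -
  have finB: "finite B" and FB: "F \<subseteq> Pow B" using assms by (auto simp: hypergraph_def)
  then have finF: "finite F" by (auto intro: finite_subset)
  define P where "P = (SIGMA T:Pow B. Pow {f \<in> F. \<not> f \<subseteq> T})"
  have bij: "bij_betw (\<lambda>(T, S). T <+> S) P (independent_sets (B <+> F) (expanded_edge ` F))"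
    unfolding bij_betw_def
  proof
    show "inj_on (\<lambda>(T, S). T <+> S) P"
      by (rule inj_onI) (auto simp: Plus_def set_eq_iff image_iff)
    show "(\<lambda>(T, S). T <+> S) ` P = independent_sets (B <+> F) (expanded_edge ` F)"
    proof (intro equalityI subsetI)
      fix I assume "I \<in> (\<lambda>(T, S). T <+> S) ` P"
      then show "I \<in> independent_sets (B <+> F) (expanded_edge ` F)"
        by (fastforce simp: P_def independent_sets_def expanded_edge_def)
    next
      fix I assume I: "I \<in> independent_sets (B <+> F) (expanded_edge ` F)"
      \<comment> \<open>This equation has \<open>I\<close> on both sides and would loop as a rewrite rule.\<close>
      have split: "I = (Inl -` I) <+> (Inr -` I)"
        by (auto simp: Plus_def image_iff) (metis sum.exhaust)
      have "\<not> f \<subseteq> Inl -` I" if "f \<in> F" "Inr f \<in> I" for f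
        using I that by (auto simp: independent_sets_def expanded_edge_def)
      then have "(Inl -` I, Inr -` I) \<in> P"
        using I by (auto simp: P_def independent_sets_def)
      moreover have "I = (\<lambda>(T, S). T <+> S) (Inl -` I, Inr -` I)"
        unfolding prod.case by (rule split)
      ultimately show "I \<in> (\<lambda>(T, S). T <+> S) ` P" by (rule rev_image_eqI)
    qed
  qed
  have "poly (independence_poly (B <+> F) (expanded_edge ` F)) z
      = (\<Sum>p\<in>P. z ^ card (case p of (T, S) \<Rightarrow> T <+> S))"
    unfolding poly_independence_poly by (rule sum.reindex_bij_betw[OF bij, symmetric])
  also have "\<dots> = (\<Sum>p\<in>P. z ^ card (fst p) * z ^ card (snd p))"
  proof (rule sum.cong)
    fix p assume "p \<in> P"
    then have "fst p \<subseteq> B" "snd p \<subseteq> F" by (auto simp: P_def)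
    then have "finite (fst p)" "finite (snd p)"
      using finB finF by (auto intro: finite_subset)
    then show "z ^ card (case p of (T, S) \<Rightarrow> T <+> S) = z ^ card (fst p) * z ^ card (snd p)"
      by (simp add: case_prod_unfold card_Plus power_add)
  qed simp
  also have "\<dots> = (\<Sum>T\<in>Pow B. \<Sum>S\<in>Pow {f \<in> F. \<not> f \<subseteq> T}. z ^ card T * z ^ card S)"
    unfolding P_def using finB finF by (subst sum.Sigma) (auto simp: case_prod_unfold)
  also have "\<dots> = (\<Sum>T\<in>Pow B. z ^ card T * (1 + z) ^ card {f \<in> F. \<not> f \<subseteq> T})"
  proof (rule sum.cong)
    fix T
    show "(\<Sum>S\<in>Pow {f \<in> F. \<not> f \<subseteq> T}. z ^ card T * z ^ card S)
        = z ^ card T * (1 + z) ^ card {f \<in> F. \<not> f \<subseteq> T}"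
      using sum_power_card_Pow[of "{f \<in> F. \<not> f \<subseteq> T}" z 1] finF
      by (simp add: sum_distrib_left[symmetric] add.commute)
  qed simp
  finally show ?thesis .
qed

section \<open>A sign change of the independence polynomial\<close>

text \<open>Count the incidences between \<open>U\<close> and the edges: every vertex of \<open>U\<close> contributes at least
  \<open>\<delta>\<close> of them, and every edge at most \<open>r\<close>.\<close>

lemma card_edges_hitting_ge:
  assumes "hypergraph B F" and "uniform_edges r F" and "U \<subseteq> B"
    and "\<And>v. v \<in> B \<Longrightarrow> \<delta> \<le> vertex_degree F v"
  shows "\<delta> * card U \<le> r * card {f \<in> F. f \<inter> U \<noteq> {}}"
proof -
  have finU: "finite U" and finF: "finite F"
    using assms(1,3) by (auto simp: hypergraph_def intro: finite_subset)
  define T where "T = {f \<in> F. f \<inter> U \<noteq> {}}"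
  have "\<delta> * card U \<le> (\<Sum>v\<in>U. vertex_degree F v)"
    using sum_mono[of U "\<lambda>_. \<delta>" "vertex_degree F"] assms(3,4) by (auto simp: mult.commute)
  also have "\<dots> = (\<Sum>v\<in>U. card {f \<in> T. v \<in> f})"
    unfolding vertex_degree_def T_def by (intro sum.cong refl arg_cong[where f = card]) auto
  also have "\<dots> = (\<Sum>f\<in>T. card {v \<in> U. v \<in> f})"
    by (rule sum_multicount_gen) (use finU finF in \<open>auto simp: T_def\<close>)
  also have "\<dots> \<le> (\<Sum>f\<in>T. r)"
  proof (rule sum_mono)
    fix f assume "f \<in> T"
    then have "finite f" "card f = r" using assms(2) by (auto simp: T_def uniform_edges_def)
    then show "card {v \<in> U. v \<in> f} \<le> r" by (metis (no_types, lifting) card_mono mem_Collect_eq subsetI)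
  qed
  finally show ?thesis by (simp add: T_def mult.commute)
qed

text \<open>With \<open>q = exp (- x \<delta> / r)\<close>, the term of \<open>T\<close> is at most \<open>x ^ card T * q ^ card (B - T)\<close>, since
  \<open>B - T\<close> meets many edges. Over all \<open>T\<close> these bounds sum to \<open>(x + q) ^ card B\<close>, while the true
  term of \<open>T = B\<close> is \<open>- (x ^ card B)\<close> by parity. The smallness assumption gives
  \<open>(x + q) ^ card B \<le> 2 * x ^ card B\<close> because \<open>1 + q / x \<le> exp (q / x)\<close>.\<close>

lemma independence_poly_expansion_nonpos:
  fixes x :: real
  assumes "hypergraph B F" and "uniform_edges r F" and "r > 0"
    and "\<And>v. v \<in> B \<Longrightarrow> \<delta> \<le> vertex_degree F v"
    and "odd (card B)" and "0 < x" and "x \<le> 1"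
    and small: "card B * exp (- (x * \<delta> / r)) / x \<le> ln 2"
  shows "poly (independence_poly (B <+> F) (expanded_edge ` F)) (- x) \<le> 0"
proof -
  define q where "q = exp (- (x * \<delta> / r))"
  define t where "t = (\<lambda>T. (- x) ^ card T * (1 - x) ^ card {f \<in> F. \<not> f \<subseteq> T})"
  have finB: "finite B" and FB: "F \<subseteq> Pow B" using assms(1) by (auto simp: hypergraph_def)
  have bound: "t T \<le> x ^ card T * q ^ card (B - T)" if "T \<subseteq> B" for T
  proof -
    define h where "h = card {f \<in> F. \<not> f \<subseteq> T}"
    have "{f \<in> F. f \<inter> (B - T) \<noteq> {}} = {f \<in> F. \<not> f \<subseteq> T}" using FB by auto
    then have "\<delta> * card (B - T) \<le> r * h"
      using card_edges_hitting_ge[OF assms(1,2) _ assms(4), of "B - T"] by (simp add: h_def)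
    then have "real \<delta> * card (B - T) \<le> r * h" by (metis of_nat_le_iff of_nat_mult)
    then have le: "x * (\<delta> / r) * card (B - T) \<le> x * h"
      using assms(3,6) by (simp add: field_simps)
    have "(1 - x) ^ h \<le> exp (- x) ^ h"
      using assms(7) exp_ge_add_one_self[of "- x"] by (intro power_mono) auto
    also have "\<dots> = exp (- (x * h))" by (simp add: exp_of_nat_mult[symmetric] mult.commute)
    also have "\<dots> \<le> exp (- (x * (\<delta> / r) * card (B - T)))" using le by simp
    also have "\<dots> = q ^ card (B - T)"
      by (simp add: q_def exp_of_nat_mult[symmetric] mult.commute)
    finally have "(1 - x) ^ h \<le> q ^ card (B - T)" .
    moreover have "(- x) ^ card T \<le> x ^ card T"
      using assms(6) by (metis abs_ge_self abs_minus_cancel abs_of_pos power_abs)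
    ultimately show ?thesis
      unfolding t_def h_def[symmetric] using assms(6,7)
      by (intro mult_mono) auto
  qed
  have top: "t B = - (x ^ card B)"
  proof -
    have "{f \<in> F. \<not> f \<subseteq> B} = {}" using FB by auto
    then have "t B = (- x) ^ card B" unfolding t_def by (simp only: card.empty power_0 mult_1_right)
    then show ?thesis using assms(5) by simp
  qed
  have split: "(\<Sum>T\<in>Pow B. g T) = g B + (\<Sum>T\<in>Pow B - {B}. g T)" for g :: "_ \<Rightarrow> real"
    using finB by (simp add: sum.remove[of "Pow B" B])
  have "poly (independence_poly (B <+> F) (expanded_edge ` F)) (- x) = (\<Sum>T\<in>Pow B. t T)"
    by (simp add: poly_independence_poly_expansion[OF assms(1)] t_def)
  also have "\<dots> \<le> - (x ^ card B) + (\<Sum>T\<in>Pow B - {B}. x ^ card T * q ^ card (B - T))"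
    unfolding split[of t] top by (intro add_left_mono sum_mono bound) auto
  also have "\<dots> = (x + q) ^ card B - 2 * x ^ card B"
    using split[of "\<lambda>T. x ^ card T * q ^ card (B - T)"] sum_power_card_Pow[OF finB, of x q]
    by simp
  also have "\<dots> \<le> 0"
  proof -
    have "(1 + q / x) ^ card B \<le> exp (q / x) ^ card B"
      using assms(6) by (intro power_mono) (auto simp: q_def)
    also have "\<dots> = exp (card B * q / x)" by (simp add: exp_of_nat_mult[symmetric])
    also have "\<dots> \<le> exp (ln 2)" using small unfolding q_def by (simp only: exp_le_cancel_iff)
    finally have "(1 + q / x) ^ card B \<le> 2" by simp
    moreover have "(x + q) ^ card B = x ^ card B * (1 + q / x) ^ card B"
      using assms(6) by (simp add: power_mult_distrib[symmetric] field_simps)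
    ultimately show ?thesis using assms(6) by (simp add: mult.commute)
  qed
  finally show ?thesis .
qed

lemma poly_root_if_nonpos:
  fixes x :: real
  assumes "poly p 0 = 1" and "0 < x" and "poly p (- x) \<le> 0"
  shows "\<exists>z. - x \<le> z \<and> z < 0 \<and> poly p z = 0"
proof -
  obtain z where "- x \<le> z" "z \<le> 0" "poly p z = 0"
    using IVT[of "poly p" "- x" 0 0] assms by auto
  moreover have "z \<noteq> 0" using assms(1) \<open>poly p z = 0\<close> by auto
  ultimately show ?thesis by auto
qed

section \<open>A nearly regular linear hypergraph on an odd number of vertices\<close>

definition line :: "nat \<Rightarrow> int \<Rightarrow> int \<Rightarrow> int \<Rightarrow> (int \<times> int) set" where
  "line r m a b = (\<lambda>i. (i, (a + i * b) mod m)) ` {0..<int r}"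

text \<open>The origin is left out, together with the lines through it (those of intercept \<open>a = 0\<close>), so
  that the number of points is odd when \<open>m\<close> is even.\<close>

definition line_points :: "nat \<Rightarrow> int \<Rightarrow> (int \<times> int) set" where
  "line_points r m = {0..<int r} \<times> {0..<m} - {(0, 0)}"

definition lines :: "nat \<Rightarrow> int \<Rightarrow> nat \<Rightarrow> (int \<times> int) set set" where
  "lines r m d = {line r m a b |a b. 1 \<le> a \<and> a < m \<and> 0 \<le> b \<and> b < int d}"

lemma mem_line_iff: "(i, c) \<in> line r m a b \<longleftrightarrow> 0 \<le> i \<and> i < int r \<and> c = (a + i * b) mod m"
  by (auto simp: line_def)

text \<open>The product \<open>i * (b - b')\<close> is smaller than \<open>m\<close> in absolute value, so it is divisible by \<open>m\<close>
  only if it vanishes. This replaces the cancellation of \<open>i\<close> that a prime modulus would allow.\<close>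

lemma slope_eq_if_congruent:
  fixes b b' i m :: int
  assumes "m dvd i * (b - b')" and "i \<noteq> 0" and "\<bar>i\<bar> < int r"
    and "0 \<le> b" "b < int d" "0 \<le> b'" "b' < int d" and "int r * int d \<le> m"
  shows "b = b'"
proof (rule ccontr)
  assume "b \<noteq> b'"
  then have "\<bar>m\<bar> \<le> \<bar>i * (b - b')\<bar>" using assms(1,2) by (intro dvd_imp_le_int) auto
  also have "\<dots> = \<bar>i\<bar> * \<bar>b - b'\<bar>" by (simp add: abs_mult)
  also have "\<dots> < int r * int d"
    using assms by (intro mult_strict_mono) auto
  finally show False using assms(8) by simp
qed

text \<open>Subtracting the two equations at \<open>i\<close> and \<open>j\<close> eliminates the intercepts.\<close>

lemma line_determined_by_two_points:
  fixes m :: int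
  assumes "(i, c) \<in> line r m a b" "(i, c) \<in> line r m a' b'"
    and "(j, c') \<in> line r m a b" "(j, c') \<in> line r m a' b'" and "i \<noteq> j"
    and "0 \<le> b" "b < int d" "0 \<le> b'" "b' < int d" and "int r * int d \<le> m"
    and "0 \<le> a" "a < m" "0 \<le> a'" "a' < m"
  shows "a = a' \<and> b = b'"
proof -
  have 1: "m dvd (a + i * b) - (a' + i * b')" and 2: "m dvd (a + j * b) - (a' + j * b')"
    using assms(1-4) by (auto simp: mem_line_iff mod_eq_dvd_iff)
  have "m dvd ((a + i * b) - (a' + i * b')) - ((a + j * b) - (a' + j * b'))"
    using 1 2 by (rule dvd_diff)
  then have "m dvd (i - j) * (b - b')" by (simp add: algebra_simps)
  moreover have "\<bar>i - j\<bar> < int r" using assms(1,3) by (auto simp: mem_line_iff)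
  ultimately have b: "b = b'"
    using slope_eq_if_congruent[of m "i - j" b b' r d] assms(5-10) by auto
  then have "a mod m = a' mod m" using 1 by (simp add: mod_eq_dvd_iff)
  then show ?thesis using b assms by simp
qed

lemma hypergraph_lines: "hypergraph (line_points r m) (lines r m d)"
  unfolding hypergraph_def
proof
  show "finite (line_points r m)" by (simp add: line_points_def)
  have "line r m a b \<subseteq> line_points r m" if "1 \<le> a" "a < m" for a b
    using that zdvd_not_zless[of a m] by (auto simp: line_def line_points_def)
  then show "lines r m d \<subseteq> Pow (line_points r m)" by (auto simp: lines_def)
qed

lemma card_line: "finite (line r m a b)" "card (line r m a b) = r"
proof -
  have "inj_on (\<lambda>i. (i, (a + i * b) mod m)) {0..<int r}" by (auto intro: inj_onI)
  then show "card (line r m a b) = r" by (simp add: line_def card_image)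
qed (simp add: line_def)

lemma uniform_edges_lines: "uniform_edges r (lines r m d)"
  by (auto simp: uniform_edges_def lines_def card_line)

lemma linear_edges_lines:
  assumes "int r * int d \<le> m"
  shows "linear_edges (lines r m d)"
  unfolding linear_edges_def
proof (intro ballI impI)
  fix e f assume "e \<in> lines r m d" "f \<in> lines r m d" and ne: "e \<noteq> f"
  then obtain a b a' b' where e: "e = line r m a b" "1 \<le> a" "a < m" "0 \<le> b" "b < int d"
    and f: "f = line r m a' b'" "1 \<le> a'" "a' < m" "0 \<le> b'" "b' < int d"
    by (auto simp: lines_def)
  have "p = p'" if "p \<in> e \<inter> f" "p' \<in> e \<inter> f" for p p'
  proof (rule ccontr)
    assume "p \<noteq> p'"
    obtain i c j c' where p: "p = (i, c)" "p' = (j, c')" by (cases p; cases p')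
    then have "i \<noteq> j" using that \<open>p \<noteq> p'\<close> e(1) by (auto simp: mem_line_iff)
    then have "a = a' \<and> b = b'"
      using line_determined_by_two_points[of i c r m a b a' b' j c' d] that p e f assms by auto
    then show False using e(1) f(1) ne by simp
  qed
  then have "card (e \<inter> f) \<le> 1"
    by (metis One_nat_def card.infinite card_le_Suc0_iff_eq le_SucI le_zero_eq linear)
  then show "finite (e \<inter> f) \<and> card (e \<inter> f) \<le> 1" using e(1) by (simp add: card_line)
qed

lemma card_line_points:
  assumes "0 < r" and "0 < m"
  shows "card (line_points r m) = r * nat m - 1"
  using assms by (simp add: line_points_def card_Diff_singleton card_cartesian_product)

text \<open>Each slope \<open>b\<close> admits exactly one line through \<open>(i, c)\<close>, of intercept \<open>(c - i * b) mod m\<close>. It was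
  removed precisely when this intercept is \<open>0\<close>.\<close>

lemma vertex_degree_lines:
  assumes "2 \<le> r" and "0 < d" and "int r * int d \<le> m" and "(i, c) \<in> line_points r m"
  shows "vertex_degree (lines r m d) (i, c) = card {b \<in> {0..<int d}. (c - i * b) mod m \<noteq> 0}"
proof -
  define S where "S = {b \<in> {0..<int d}. (c - i * b) mod m \<noteq> 0}"
  define L where "L = (\<lambda>b. line r m ((c - i * b) mod m) b)"
  have ic: "0 \<le> i" "i < int r" "0 \<le> c" "c < m" using assms(4) by (auto simp: line_points_def)
  then have m: "0 < m" by simp
  have "{e \<in> lines r m d. (i, c) \<in> e} = L ` S"
  proof (intro equalityI subsetI)
    fix e assume "e \<in> {e \<in> lines r m d. (i, c) \<in> e}"
    then obtain a b where e: "e = line r m a b" "1 \<le> a" "a < m" "0 \<le> b" "b < int d"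
      and "(i, c) \<in> e" by (auto simp: lines_def)
    then have "c = (a + i * b) mod m" by (simp add: mem_line_iff)
    then have "(c - i * b) mod m = a" using e by (simp add: mod_diff_left_eq)
    then have "e = L b" "b \<in> S" using e by (auto simp: L_def S_def)
    then show "e \<in> L ` S" by simp
  next
    fix e assume "e \<in> L ` S"
    then obtain b where b: "b \<in> S" "e = L b" by auto
    moreover have "0 \<le> (c - i * b) mod m" "(c - i * b) mod m < m" using m by simp_all
    ultimately have "e \<in> lines r m d" unfolding lines_def L_def S_def
      by (smt (verit) atLeastLessThan_iff mem_Collect_eq)
    moreover have "((c - i * b) mod m + i * b) mod m = c"
      using ic by (simp add: mod_add_left_eq)
    ultimately show "e \<in> {e \<in> lines r m d. (i, c) \<in> e}"
      using b ic by (auto simp: L_def mem_line_iff)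
  qed
  moreover have "inj_on L S"
  proof (rule inj_onI)
    fix b b' assume b: "b \<in> S" "b' \<in> S" "L b = L b'"
    \<comment> \<open>Two common points are needed to compare lines; \<open>j\<close> is any other column, which exists as
      \<open>2 \<le> r\<close>.\<close>
    define j where "j = (if i = 0 then 1 else 0::int)"
    define c' where "c' = ((c - i * b) mod m + j * b) mod m"
    have "(i, c) \<in> L b" "(i, c) \<in> L b'"
      using ic by (auto simp: L_def mem_line_iff mod_add_left_eq)
    moreover have "(j, c') \<in> L b" using assms(1) by (auto simp: L_def mem_line_iff j_def c'_def)
    ultimately show "b = b'"
      using line_determined_by_two_points[of i c r m "(c - i * b) mod m" b "(c - i * b') mod m" b' j c' d]
        b assms(3) m by (auto simp: L_def S_def j_def split: if_splits)
  qed
  ultimately show ?thesis by (simp add: vertex_degree_def card_image S_def)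
qed

lemma vertex_degree_lines_le:
  assumes "2 \<le> r" and "0 < d" and "int r * int d \<le> m" and "v \<in> line_points r m"
  shows "vertex_degree (lines r m d) v \<le> d"
proof (cases v)
  case (Pair i c)
  have "card {b \<in> {0..<int d}. (c - i * b) mod m \<noteq> 0} \<le> card {0..<int d}"
    by (intro card_mono) auto
  then show ?thesis using vertex_degree_lines[of r d m i c] assms Pair by simp
qed

text \<open>At most one line is lost at each point, namely the one joining it to the origin.\<close>

lemma vertex_degree_lines_ge:
  assumes "2 \<le> r" and "0 < d" and "int r * int d \<le> m" and "v \<in> line_points r m"
  shows "d - 1 \<le> vertex_degree (lines r m d) v"
proof (cases v)
  case (Pair i c)
  have ic: "0 \<le> i" "i < int r" "0 \<le> c" "c < m" "(i, c) \<noteq> (0, 0)"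
    using assms(4) Pair by (auto simp: line_points_def)
  define N where "N = {b \<in> {0..<int d}. (c - i * b) mod m = 0}"
  have "b = b'" if "b \<in> N" "b' \<in> N" for b b'
  proof (cases "i = 0")
    case True
    then show ?thesis using that ic by (auto simp: N_def)
  next
    case False
    have "m dvd (c - i * b') - (c - i * b)" 
      using that unfolding N_def by (intro dvd_diff mod_0_imp_dvd) blast+
    then have "m dvd i * (b - b')" by (simp add: algebra_simps)
    then show ?thesis
      using slope_eq_if_congruent[of m i b b' r d] that ic False assms(3) by (auto simp: N_def)
  qed
  moreover have finN: "finite N"
    by (rule finite_subset[of _ "{0..<int d}"]) (auto simp: N_def)
  ultimately have "card N \<le> 1" by (metis One_nat_def card_le_Suc0_iff_eq)
  moreover have "{b \<in> {0..<int d}. (c - i * b) mod m \<noteq> 0} = {0..<int d} - N" by (auto simp: N_def)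
  moreover have "card ({0..<int d} - N) = d - card N"
    using finN by (subst card_Diff_subset) (auto simp: N_def)
  ultimately show ?thesis using vertex_degree_lines[of r d m i c] assms Pair by simp
qed

lemma vertex_degree_lines_01:
  assumes "2 \<le> r" and "0 < d" and "int r * int d \<le> m"
  shows "(0, 1) \<in> line_points r m" and "vertex_degree (lines r m d) (0, 1) = d"
proof -
  have "2 * 1 \<le> int r * int d" using assms(1,2) by (intro mult_mono) auto
  then have m: "1 < m" using assms(3) by linarith
  then show *: "(0, 1) \<in> line_points r m" using assms(1) by (auto simp: line_points_def)
  have "{b \<in> {0..<int d}. (1 - 0 * b) mod m \<noteq> 0} = {0..<int d}" using m by auto
  then show "vertex_degree (lines r m d) (0, 1) = d"
    using vertex_degree_lines[OF assms *] by simp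
qed

section \<open>Locating the zero\<close>

lemma ln_le_sqrt:
  fixes y :: real
  assumes "0 < y"
  shows "ln y \<le> sqrt y"
proof -
  \<comment> \<open>The tangent of \<open>ln\<close> at \<open>2\<close>, evaluated at \<open>sqrt y\<close>; the tangent at \<open>1\<close> would give only \<open>ln y \<le> 2 * sqrt y - 2\<close>, which
    is too weak to ensure \<open>6 k ln \<Delta> \<le> \<Delta>\<close> below.\<close>
  have "ln (sqrt y / 2) \<le> sqrt y / 2 - 1" using assms by (intro ln_le_minus_one) simp
  moreover have "ln (sqrt y / 2) = ln y / 2 - ln 2" using assms by (simp add: ln_div ln_sqrt)
  moreover have "ln 2 \<le> (1::real)" using ln_le_minus_one[of 2] by simp
  ultimately show ?thesis by simp
qed

text \<open>The exponent is at most \<open>- 3 ln d\<close>, so the exponential is at most \<open>1 / d ^ 3\<close>. The number of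
  points is at most \<open>2 k\<^sup>2 d \<le> d\<^sup>2 / 50\<close> and \<open>1 / x \<le> d\<close>, so the product is at most \<open>1 / 50\<close>.\<close>

lemma zero_location_estimates:
  fixes k d :: nat and x :: real
  assumes "3 \<le> k" and "100 * k ^ 2 < d"
  defines "x \<equiv> 6 * real k * ln d / d"
  shows "0 < x" and "x \<le> 1"
    and "real (2 * (k - 1)\<^sup>2 * d - 1) * exp (- (x * real (d - 1) / real (k - 1))) / x \<le> ln 2"
proof -
  have d2: "100 * (real k)\<^sup>2 < d" using assms(2) by (metis of_nat_less_iff of_nat_mult of_nat_numeral of_nat_power)
  have "9 \<le> (real k)\<^sup>2" using assms(1) power_mono[of 3 "real k" 2] by simp
  then have d900: "900 < real d" using d2 by linarith
  have lnd: "1 \<le> ln d"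
    using d900 exp_le by (subst ln_ge_iff) auto
  show x0: "0 < x" using assms(1) lnd d900 by (simp add: x_def)
  have "6 * real k \<le> sqrt d"
    using d2 by (intro real_le_rsqrt) (simp add: power2_eq_square)
  then have "6 * real k * ln d \<le> sqrt d * sqrt d"
    using ln_le_sqrt[of d] d900 lnd by (intro mult_mono) auto
  then show "x \<le> 1" using d900 by (simp add: x_def)
  have x_ge: "1 / d \<le> x"
  proof -
    have "1 * 1 \<le> (6 * real k) * ln d" using assms(1) lnd by (intro mult_mono) auto
    then show ?thesis using d900 by (simp add: x_def divide_right_mono)
  qed
  have "3 * ln d \<le> x * real (d - 1) / real (k - 1)"
  proof -
    have "x * real (d - 1) / real (k - 1) = 6 * ln d * (real (d - 1) / d) * (k / real (k - 1))"
      using assms(1) by (simp add: x_def)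
    moreover have "3 * ln d * 1 \<le> 6 * ln d * (real (d - 1) / d) * (k / real (k - 1))"
    proof (rule mult_mono)
      have d1: "real (d - 1) = real d - 1" using d900 by (simp add: of_nat_diff)
      have "1 / 2 \<le> real (d - 1) / d" unfolding d1 using d900 by (simp add: field_simps)
      then have "(6 * ln d) * (1 / 2) \<le> (6 * ln d) * (real (d - 1) / d)"
        by (rule mult_left_mono) (use lnd in simp)
      then show "3 * ln d \<le> 6 * ln d * (real (d - 1) / d)" by simp
      show "1 \<le> k / real (k - 1)" using assms(1) by (simp add: of_nat_diff field_simps)
    qed (use lnd in auto)
    ultimately show ?thesis by simp
  qed
  then have "exp (- (x * real (d - 1) / real (k - 1))) \<le> exp (- (3 * ln d))" by simp
  also have "\<dots> = 1 / real d ^ 3"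
  proof -
    have "exp (3 * ln d) = real d ^ 3"
      using d900 exp_of_nat_mult[of 3 "ln d"] by simp
    then show ?thesis by (simp add: exp_minus inverse_eq_divide)
  qed
  finally have e: "exp (- (x * real (d - 1) / real (k - 1))) \<le> 1 / real d ^ 3" .
  have "real (2 * (k - 1)\<^sup>2 * d - 1) \<le> 2 * (real k)\<^sup>2 * d"
  proof -
    have "(k - 1)\<^sup>2 \<le> k\<^sup>2" by (intro power_mono) auto
    then have "2 * (k - 1)\<^sup>2 * d - 1 \<le> 2 * k\<^sup>2 * d"
      by (meson diff_le_self le_trans mult_le_mono order_refl)
    then have "real (2 * (k - 1)\<^sup>2 * d - 1) \<le> real (2 * k\<^sup>2 * d)" by (rule of_nat_mono)
    then show ?thesis by simp
  qed
  also have "\<dots> \<le> (real d / 50) * d" using d2 by (intro mult_right_mono) auto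
  finally have b: "real (2 * (k - 1)\<^sup>2 * d - 1) \<le> (real d)\<^sup>2 / 50" by (simp add: power2_eq_square)
  have "real (2 * (k - 1)\<^sup>2 * d - 1) * exp (- (x * real (d - 1) / real (k - 1))) / x
      \<le> ((real d)\<^sup>2 / 50) * (1 / real d ^ 3) / (1 / d)"
    using b e x_ge d900 by (intro frac_le mult_mono) auto
  also have "\<dots> = 1 / 50" using d900 by (simp add: power2_eq_square power3_eq_cube)
  also have "\<dots> \<le> ln 2" using ln_le_minus_one[of "1 / 2 :: real"] by (simp add: ln_div)
  finally show "real (2 * (k - 1)\<^sup>2 * d - 1) * exp (- (x * real (d - 1) / real (k - 1))) / x \<le> ln 2" .
qed

theorem theorem1p2:
  fixes k \<Delta> :: nat
  assumes "k \<ge> 3" and "\<Delta> > 100 * k ^ 2"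
  shows "\<exists>(V :: nat set) (E :: nat set set).
           hypergraph V E \<and> uniform_edges k E \<and> linear_edges E \<and> max_degree V E = \<Delta> \<and>
           (\<exists>z :: real. z < 0 \<and> z \<in> {- (6 * real k * ln (real \<Delta>) / real \<Delta>)..0} \<and>
              poly (independence_poly V E) z = 0)"
proof -
  define r where "r = k - 1"
  define m where "m = 2 * int r * int \<Delta>"
  define x where "x = 6 * real k * ln (real \<Delta>) / real \<Delta>"
  define B where "B = line_points r m"
  define F where "F = lines r m \<Delta>"
  define V where "V = B <+> F"
  define E where "E = expanded_edge ` F"
  have r: "2 \<le> r" "Suc r = k" and \<Delta>: "0 < \<Delta>" using assms by (auto simp: r_def)
  have m: "int r * int \<Delta> \<le> m" "0 < m" using r \<Delta> by (auto simp: m_def)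
  have H: "hypergraph B F" by (simp add: B_def F_def hypergraph_lines)
  have hV: "hypergraph V E" unfolding V_def E_def by (rule hypergraph_expansion[OF H])
  have uE: "uniform_edges k E"
    unfolding E_def F_def r(2)[symmetric] by (intro uniform_edges_expansion uniform_edges_lines)
  have lE: "linear_edges E"
    unfolding E_def F_def using m(1) by (intro linear_edges_expansion linear_edges_lines)
  have dE: "max_degree V E = \<Delta>"
    unfolding V_def E_def
    by (rule max_degree_expansion[OF H, of "(0, 1)"])
      (use r \<Delta> m vertex_degree_lines_01 vertex_degree_lines_le in \<open>auto simp: B_def F_def\<close>)
  have "nat m = 2 * r * \<Delta>" unfolding m_def by (metis nat_int of_nat_mult of_nat_numeral)
  then have cB: "card B = 2 * (k - 1)\<^sup>2 * \<Delta> - 1"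
    using card_line_points[of r m] r m by (simp add: B_def r_def power2_eq_square mult_ac)
  have odd: "odd (card B)"
    using r \<Delta> unfolding cB r_def[symmetric] by (simp add: even_diff_nat)
  note x = zero_location_estimates[OF assms, folded x_def]
  have neg: "poly (independence_poly V E) (- x) \<le> 0"
    unfolding V_def E_def
  proof (rule independence_poly_expansion_nonpos[OF H, where r = r and \<delta> = "\<Delta> - 1"])
    show "uniform_edges r F" by (simp add: F_def uniform_edges_lines)
    show "\<Delta> - 1 \<le> vertex_degree F v" if "v \<in> B" for v
      using vertex_degree_lines_ge[OF r(1) \<Delta> m(1), of v] that by (simp add: B_def F_def)
    show "card B * exp (- (x * real (\<Delta> - 1) / real r)) / x \<le> ln 2"
      using x(3) unfolding cB r_def .
  qed (use r x odd in auto)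
  have "{} \<notin> E" by (auto simp: E_def expanded_edge_def)
  then have "poly (independence_poly V E) 0 = 1"
    using hV by (intro poly_independence_poly_0) (auto simp: hypergraph_def)
  then obtain z where z: "- x \<le> z" "z < 0" "poly (independence_poly V E) z = 0"
    using poly_root_if_nonpos x(1) neg by blast
  have finV: "finite V" and EV: "E \<subseteq> Pow V" using hV by (auto simp: hypergraph_def)
  then obtain \<phi> :: "_ \<Rightarrow> nat" where \<phi>: "inj_on \<phi> V"
    using finite_imp_inj_to_nat_seg by blast
  show ?thesis
  proof (intro exI conjI)
    show "hypergraph (\<phi> ` V) ((`) \<phi> ` E)" using hV by (rule hypergraph_image)
    show "uniform_edges k ((`) \<phi> ` E)" using \<phi> EV uE by (rule uniform_edges_image)
    show "linear_edges ((`) \<phi> ` E)" using \<phi> EV lE by (rule linear_edges_image)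
    show "max_degree (\<phi> ` V) ((`) \<phi> ` E) = \<Delta>" using max_degree_image[OF \<phi> EV] dE by simp
    show "z < 0" by (rule z)
    show "z \<in> {- (6 * real k * ln (real \<Delta>) / real \<Delta>)..0}" using z by (simp add: x_def)
    show "poly (independence_poly (\<phi> ` V) ((`) \<phi> ` E)) z = 0"
      using independence_poly_image[OF \<phi> EV] z(3) by simp
  qed
qed

end
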